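(* Let $N,M$ be positive integers, let $\mathcal A,\mathcal M\in\mathbb C^{N\times N}$ with $\mathcal A$ Hermitian positive semi-definite and $\mathcal M$ Hermitian positive definite, let $\mathcal B\in\mathbb C^{N\times M}$ satisfy $\mathcal A\mathcal M^{-1}\mathcal B=0$, let $\mathcal U\in\mathbb C^{M\times M}$ be Hermitian positive definite, let $c>0$ be real, and let $\mathcal F\in\mathbb C^N$. Suppose $\dim\mathbb C_0\neq 0$, and let $\mathcal H\in\mathbb C^{N\times\dim\mathbb C_0}$ be a matrix whose columns form an $\mathcal M$-orthonormal basis of $\mathbb C_0$ (equivalently, of the eigenspace for the zero eigenvalue of $(\mathcal A+\mathcal B\mathcal U\mathcal B^* )u=\lambda\mathcal M u$). Then the constrained system $$(\mathcal A+c\mathcal M)u+\mathcal B p=\mathcal F,\qquad \mathcal B^* u=0\qquad (u\in\mathbb C^N,\ p\in\mathbb C^M)$$ has a solution $(u,p)$ whose component $u$ is unique, and this $u$ is obtained as follows: there is a unique $\tilde u\in\mathbb C^N$ with $$(\mathcal A+\mathcal B\mathcal U\mathcal B^*+\mathcal M\mathcal H\mathcal H^*\mathcal M)\tilde u=\mathcal F,$$ and then $u$ is the unique solution in $\mathbb C^N$ of $$(\mathcal A+\mathcal B\mathcal U\mathcal B^*+c\mathcal M)u=\mathcal F-\mathcal B\mathcal U\mathcal B^*\tilde u.$$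
   Context: $X^*$ denotes the conjugate transpose of a matrix $X$. $\mathbb C_0:=\operatorname{Ker}\mathcal A\cap\operatorname{Ker}(\mathcal B\mathcal U\mathcal B^* )\subset\mathbb C^N$. $\mathcal M$-orthonormal means orthonormal for the inner product $(v,w)\mapsto w^*\mathcal M v$, i.e. $\mathcal H^*\mathcal M\mathcal H=I$. *)

theory Defs
  imports "HOL-Analysis.Analysis"
begin

definition ctranspose :: "complex^'n^'m \<Rightarrow> complex^'m^'n" where
  "ctranspose X = (\<chi> i j. cnj (X $ j $ i))"

definition cdot :: "complex^'n \<Rightarrow> complex^'n \<Rightarrow> complex" where
  "cdot w v = (\<Sum>i\<in>UNIV. cnj (w $ i) * v $ i)"

definition hermitian :: "complex^'n^'n \<Rightarrow> bool" where
  "hermitian X \<longleftrightarrow> ctranspose X = X"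

text \<open>For Hermitian \<open>X\<close> the number \<open>cdot v (X *v v)\<close> is real, so \<open>Re\<close> discards nothing.\<close>

definition hermitian_psd :: "complex^'n^'n \<Rightarrow> bool" where
  "hermitian_psd X \<longleftrightarrow> hermitian X \<and> (\<forall>v. 0 \<le> Re (cdot v (X *v v)))"

definition hermitian_pd :: "complex^'n^'n \<Rightarrow> bool" where
  "hermitian_pd X \<longleftrightarrow> hermitian X \<and> (\<forall>v. v \<noteq> 0 \<longrightarrow> 0 < Re (cdot v (X *v v)))"

definition Ker :: "complex^'n^'m \<Rightarrow> (complex^'n) set" where
  "Ker X = {v. X *v v = 0}"

definition BUBs :: "complex^'m^'n \<Rightarrow> complex^'m^'m \<Rightarrow> complex^'n^'n" where
  "BUBs B U = B ** U ** ctranspose B"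

definition C0 :: "complex^'n^'n \<Rightarrow> complex^'m^'n \<Rightarrow> complex^'m^'m \<Rightarrow> (complex^'n) set" where
  "C0 A B U = Ker A \<inter> Ker (BUBs B U)"

definition gen_eigenspace ::
    "complex^'n^'n \<Rightarrow> complex^'n^'n \<Rightarrow> complex \<Rightarrow> (complex^'n) set" where
  "gen_eigenspace K M l = {u. K *v u = l *s (M *v u)}"

text \<open>
  The columns of \<open>H\<close> form an \<open>M\<close>-orthonormal basis of the complex subspace \<open>S\<close>;
  \<open>vec.independent\<close>, \<open>vec.span\<close> and \<open>vec.dim\<close> are the notions over the field of complex
  scalars. The number of columns is the cardinality of the index type \<open>'d\<close>.
\<close>

definition orthonormal_basis_columns ::
    "complex^'n^'n \<Rightarrow> complex^'d^'n \<Rightarrow> (complex^'n) set \<Rightarrow> bool" where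
  "orthonormal_basis_columns M H S \<longleftrightarrow>
     CARD('d) = vec.dim S \<and>
     vec.independent (columns H) \<and> vec.span (columns H) = S \<and>
     ctranspose H ** M ** H = mat 1"

definition constrained_solution ::
    "complex^'n^'n \<Rightarrow> complex^'n^'n \<Rightarrow> complex^'m^'n \<Rightarrow> real \<Rightarrow> complex^'n \<Rightarrow>
     complex^'n \<Rightarrow> complex^'m \<Rightarrow> bool" where
  "constrained_solution A M B c F u p \<longleftrightarrow>
     (A + c *\<^sub>R M) *v u + B *v p = F \<and> ctranspose B *v u = 0"

end

(*
  Put K = A + B U B^*. Testing K u = 0 with u gives Ker K = C0, so K + c M and
  K + M H H^* M are injective, hence invertible. If ut solves the system with the latter matrix,
  then F - B U B^* ut = A ut + M h with h = H H^* M ut in C0, so the second system reads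
  K u + c M u = A ut + M h. Testing it with x = M^{-1} B U B^* u, which lies in Ker A, leaves
  x^* M x + c u^* B U B^* u = 0. Hence B^* u = 0, and p = U B^* (ut + u) is a multiplier.
*)
theory Submission
  imports Defs
begin

text \<open>Moves every test to the real inner product. Only real parts of forms are ever compared,
  so no complex-valued identity is needed.\<close>

lemma Re_cdot: "Re (cdot w v) = w \<bullet> v"
  by (simp add: cdot_def inner_vec_def inner_complex_def)

lemma inner_ctranspose:
  fixes X :: "complex^'n^'m"
  shows "(ctranspose X *v w) \<bullet> v = w \<bullet> (X *v v)"
proof -
  have "cdot (ctranspose X *v w) v = (\<Sum>j\<in>UNIV. \<Sum>i\<in>UNIV. cnj (w $ i) * X $ i $ j * v $ j)"
    by (simp add: cdot_def ctranspose_def matrix_vector_mult_def sum_distrib_left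
        sum_distrib_right mult_ac)
  also have "\<dots> = cdot w (X *v v)"
    by (subst sum.swap) (simp add: cdot_def matrix_vector_mult_def sum_distrib_left mult_ac)
  finally show ?thesis
    by (metis Re_cdot)
qed

lemma inner_ctranspose':
  fixes X :: "complex^'n^'m"
  shows "v \<bullet> (ctranspose X *v w) = (X *v v) \<bullet> w"
  by (metis inner_ctranspose inner_commute)

lemma hermitian_inner:
  "hermitian X \<Longrightarrow> (X *v w) \<bullet> v = w \<bullet> (X *v v)"
  by (metis hermitian_def inner_ctranspose)

lemma scaleR_matrix_vector_mult:
  fixes X :: "complex^'n^'m"
  shows "(r *\<^sub>R X) *v v = r *\<^sub>R (X *v v)"
  by (simp add: matrix_vector_mult_def vec_eq_iff scaleR_sum_right)

lemma matrix_vector_mult_scaleR':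
  fixes X :: "complex^'n^'m"
  shows "X *v (r *\<^sub>R v) = r *\<^sub>R (X *v v)"
  by (simp add: matrix_vector_mult_def vec_eq_iff scaleR_sum_right)

text \<open>With \<open>y = X *v v\<close>, the form at \<open>v - t *\<^sub>R y\<close> has no
  constant term and linear term \<open>- 2 * t * (y \<bullet> y)\<close>, so it is negative for
  small \<open>t > 0\<close> unless \<open>y = 0\<close>.\<close>

lemma psd_form_zero_imp_kernel:
  fixes X :: "complex^'n^'n"
  assumes herm: "hermitian X" and psd: "\<And>v. 0 \<le> v \<bullet> (X *v v)" and zero: "v \<bullet> (X *v v) = 0"
  shows "X *v v = 0"
proof (rule ccontr)
  define y where "y = X *v v"
  assume "X *v v \<noteq> 0"
  then have pos: "0 < y \<bullet> y" by (simp add: y_def)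
  define b where "b = y \<bullet> (X *v y)"
  have quad: "0 \<le> t * t * b - 2 * t * (y \<bullet> y)" for t
  proof -
    have "v \<bullet> (X *v y) = y \<bullet> y"
      using hermitian_inner[OF herm, of v y] by (simp add: y_def)
    then have "(v - t *\<^sub>R y) \<bullet> (X *v (v - t *\<^sub>R y)) = t * t * b - 2 * t * (y \<bullet> y)"
      using zero
      by (simp add: matrix_vector_mult_diff_distrib matrix_vector_mult_scaleR' inner_diff
          y_def[symmetric] b_def algebra_simps)
    then show ?thesis using psd by metis
  qed
  have "0 \<le> b" using psd by (simp add: b_def)
  \<comment> \<open>Adding 1 keeps the denominator positive when \<open>b = 0\<close> and yields
    \<open>t * b < y \<bullet> y\<close>, small enough for the linear term to win.\<close>
  define t where "t = (y \<bullet> y) / (b + 1)"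
  have t: "0 < t" and tb: "t * b < y \<bullet> y"
    using pos \<open>0 \<le> b\<close> by (auto simp: t_def field_simps)
  have "t * (t * b) < t * (2 * (y \<bullet> y))"
    using t tb pos by (intro mult_strict_left_mono) linarith+
  with quad[of t] show False by (simp add: mult_ac)
qed

lemma injective_matrix_ex1:
  fixes X :: "complex^'n^'n"
  assumes "\<And>v. X *v v = 0 \<Longrightarrow> v = 0"
  shows "\<exists>!v. X *v v = b"
proof -
  have "invertible X"
    using assms matrix_left_invertible_ker[of X] by (metis invertible_left_inverse)
  then obtain Y where "X ** Y = mat 1" "Y ** X = mat 1"
    by (auto simp: invertible_def)
  then show ?thesis
    by (metis matrix_vector_mul_assoc matrix_vector_mul_lid)
qed

text \<open>The hypothesis on \<open>H\<close> speaks of a span of columns, while the proof needs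
  coordinates: a \<open>z\<close> with \<open>v = H *v z\<close>.\<close>

lemma range_matrix_vector_mult_eq_span_columns:
  fixes X :: "complex^'n^'m"
  shows "range ((*v) X) = vec.span (columns X)"
proof
  show "range ((*v) X) \<subseteq> vec.span (columns X)"
    using matrix_vector_mult_in_columnspace_gen by blast
  have "column i X = X *v axis i 1" for i
    by (simp add: column_def matrix_vector_mult_def axis_def vec_eq_iff if_distrib cong: if_cong)
  then have "columns X \<subseteq> range ((*v) X)"
    by (auto simp: columns_def)
  moreover have "vec.subspace (range ((*v) X))"
    by (intro vec.subspace_image vec.subspace_UNIV)
  ultimately show "vec.span (columns X) \<subseteq> range ((*v) X)"
    by (rule vec.span_minimal)
qed

lemma BUBs_mult_vec: "BUBs B U *v v = B *v (U *v (ctranspose B *v v))"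
  by (simp add: BUBs_def matrix_vector_mul_assoc matrix_mul_assoc)

theorem mainTheorem4:
  fixes A M :: "complex^'n^'n"
    and B :: "complex^'m^'n"
    and U :: "complex^'m^'m"
    and c :: real
    and F :: "complex^'n"
    and H :: "complex^'d^'n"
  assumes "hermitian_psd A"
    and "hermitian_pd M"
    and "A ** matrix_inv M ** B = 0"
    and "hermitian_pd U"
    and "0 < c"
    and "vec.dim (C0 A B U) \<noteq> 0"
    and "orthonormal_basis_columns M H (C0 A B U)"
  shows "gen_eigenspace (A + BUBs B U) M 0 = C0 A B U \<and>
    (\<exists>!u. \<exists>p. constrained_solution A M B c F u p) \<and>
    (\<exists>!ut. (A + BUBs B U + M ** H ** ctranspose H ** M) *v ut = F) \<and>
    (\<forall>u p ut. constrained_solution A M B c F u p \<longrightarrow>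
       (A + BUBs B U + M ** H ** ctranspose H ** M) *v ut = F \<longrightarrow>
       (\<forall>v. (A + BUBs B U + c *\<^sub>R M) *v v = F - BUBs B U *v ut \<longleftrightarrow> v = u))"
proof -
  have hA: "hermitian A" and A0: "0 \<le> v \<bullet> (A *v v)" for v
    using assms(1) by (auto simp: hermitian_psd_def Re_cdot)
  have hM: "hermitian M" and M0: "v \<noteq> 0 \<Longrightarrow> 0 < v \<bullet> (M *v v)" for v
    using assms(2) by (auto simp: hermitian_pd_def Re_cdot)
  have hU: "hermitian U" and U0: "w \<noteq> 0 \<Longrightarrow> 0 < w \<bullet> (U *v w)" for w
    using assms(4) by (auto simp: hermitian_pd_def Re_cdot)
  have M0': "0 \<le> v \<bullet> (M *v v)" for v
    using M0[of v] by (cases "v = 0") auto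
  have U0': "0 \<le> w \<bullet> (U *v w)" for w
    using U0[of w] by (cases "w = 0") auto
  define S where "S = BUBs B U"
  define P where "P = A + S + M ** H ** ctranspose H ** M"
  define Q where "Q = A + S + c *\<^sub>R M"
  have S_inner: "v \<bullet> (S *v v) = (ctranspose B *v v) \<bullet> (U *v (ctranspose B *v v))" for v
    by (simp add: S_def BUBs_mult_vec inner_ctranspose)
  have S_sym: "(S *v v) \<bullet> w = v \<bullet> (S *v w)" for v w
    unfolding S_def BUBs_mult_vec
    by (metis inner_ctranspose inner_ctranspose' hermitian_inner[OF hU])
  have S0: "0 \<le> v \<bullet> (S *v v)" for v
    using U0' by (simp add: S_inner)
  have S_zero: "ctranspose B *v v = 0" if "v \<bullet> (S *v v) = 0" for v
    using that U0 by (metis S_inner less_irrefl)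
  \<comment> \<open>Stated through the form instead of the kernel of \<open>A + S\<close>, so that
    it serves both the eigenspace claim and the injectivity of \<open>P\<close>. Both summands are
    nonnegative, so each vanishes.\<close>
  have K_ker: "v \<in> C0 A B U" if "v \<bullet> (A *v v) + v \<bullet> (S *v v) = 0" for v
  proof -
    have "v \<bullet> (A *v v) = 0" "v \<bullet> (S *v v) = 0"
      using that A0[of v] S0[of v] by linarith+
    then have "A *v v = 0" "ctranspose B *v v = 0"
      using psd_form_zero_imp_kernel[OF hA A0] S_zero by auto
    then show ?thesis
      by (simp add: C0_def Ker_def BUBs_mult_vec)
  qed
  have C0D: "A *v v = 0" "S *v v = 0" if "v \<in> C0 A B U" for v
    using that by (auto simp: C0_def Ker_def S_def)
  have range_H: "range ((*v) H) = C0 A B U" and HMH: "ctranspose H ** M ** H = mat 1"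
    using assms(7)
    by (auto simp: orthonormal_basis_columns_def range_matrix_vector_mult_eq_span_columns)
  have P_vec: "P *v v = A *v v + S *v v + M *v (H *v (ctranspose H *v (M *v v)))" for v
    by (simp add: P_def matrix_vector_mult_add_rdistrib matrix_vector_mul_assoc matrix_mul_assoc)
  have Q_vec: "Q *v v = A *v v + S *v v + c *\<^sub>R (M *v v)" for v
    by (simp add: Q_def matrix_vector_mult_add_rdistrib scaleR_matrix_vector_mult)

  have eig: "gen_eigenspace (A + S) M 0 = C0 A B U"
  proof (intro set_eqI iffI)
    fix v assume "v \<in> gen_eigenspace (A + S) M 0"
    then have "A *v v + S *v v = 0"
      by (simp add: gen_eigenspace_def matrix_vector_mult_add_rdistrib)
    then show "v \<in> C0 A B U"
      by (intro K_ker) (metis inner_add_right inner_zero_right)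
  qed (simp add: gen_eigenspace_def matrix_vector_mult_add_rdistrib C0D)

  have exP: "\<exists>!v. P *v v = b" for b
  proof (rule injective_matrix_ex1)
    fix v assume "P *v v = 0"
    define y where "y = ctranspose H *v (M *v v)"
    \<comment> \<open>Tested with \<open>v\<close>, the added term of \<open>P\<close> is a square.
      Its vanishing says that \<open>v\<close> is \<open>M\<close>-orthogonal to the columns of
      \<open>H\<close>, whose span contains \<open>v\<close>.\<close>
    have "v \<bullet> (M *v (H *v y)) = y \<bullet> y"
      by (metis hermitian_inner[OF hM] inner_ctranspose y_def)
    then have sum0: "v \<bullet> (A *v v) + v \<bullet> (S *v v) + y \<bullet> y = 0"
      using \<open>P *v v = 0\<close> by (metis P_vec y_def inner_add_right inner_zero_right)
    then have "y \<bullet> y = 0"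
      using A0[of v] S0[of v] inner_ge_zero[of y] by linarith
    then have "y = 0" by simp
    have "v \<in> range ((*v) H)"
      using K_ker sum0 \<open>y = 0\<close> range_H by auto
    then obtain z where z: "v = H *v z" by blast
    \<comment> \<open>By \<open>M\<close>-orthonormality the coordinates of \<open>v\<close> are
      recovered as \<open>ctranspose H *v (M *v v)\<close>, which is \<open>y\<close>.\<close>
    have "z = y"
      using HMH by (metis z y_def matrix_vector_mul_assoc matrix_vector_mul_lid)
    then show "v = 0" using z \<open>y = 0\<close> by simp
  qed

  have exQ: "\<exists>!v. Q *v v = b" for b
  proof (rule injective_matrix_ex1, rule ccontr)
    fix v assume "Q *v v = 0" "v \<noteq> 0"
    then have "v \<bullet> (A *v v) + v \<bullet> (S *v v) + c * (v \<bullet> (M *v v)) = 0"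
      by (metis Q_vec inner_add_right inner_zero_right inner_scaleR_right)
    moreover have "0 < c * (v \<bullet> (M *v v))"
      using M0[OF \<open>v \<noteq> 0\<close>] assms(5) by simp
    ultimately show False
      using A0[of v] S0[of v] by linarith
  qed

  \<comment> \<open>\<open>matrix_inv\<close> is a choice operator, so invertibility of
    \<open>M\<close> must come first; it follows from definiteness.\<close>
  have invM: "M ** matrix_inv M = mat 1"
  proof -
    have "M *v v = 0 \<Longrightarrow> v = 0" for v
      using M0[of v] by fastforce
    then have "invertible M"
      using matrix_left_invertible_ker[of M] by (metis invertible_left_inverse)
    then show ?thesis
      unfolding invertible_def matrix_inv_def by (rule someI2_ex) simp
  qed

  have solves: "constrained_solution A M B c F u (U *v (ctranspose B *v (ut + u)))"
    if ut: "P *v ut = F" and u: "Q *v u = F - S *v ut" for u ut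
  proof -
    define h where "h = H *v (ctranspose H *v (M *v ut))"
    have "h \<in> C0 A B U" using range_H by (auto simp: h_def)
    have eq: "A *v u + S *v u + c *\<^sub>R (M *v u) = A *v ut + M *v h"
      using u ut by (auto simp: Q_vec P_vec h_def algebra_simps)
    define x where "x = matrix_inv M *v (S *v u)"
    have Mx: "M *v x = S *v u"
      by (metis invM x_def matrix_vector_mul_assoc matrix_vector_mul_lid)
    have "A *v x = (A ** matrix_inv M ** B) *v (U *v (ctranspose B *v u))"
      by (simp add: x_def S_def BUBs_mult_vec matrix_vector_mul_assoc matrix_mul_assoc)
    then have Ax: "A *v x = 0" using assms(3) by simp
    have xA: "x \<bullet> (A *v v) = 0" for v
      using hermitian_inner[OF hA, of x v] Ax by simp
    \<comment> \<open>Pairing \<open>x\<close> with \<open>M\<close> amounts to pairing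
      \<open>u\<close> with \<open>S\<close>. Thus \<open>M *v h\<close> drops out, as
      \<open>S\<close> kills \<open>h\<close>, and the \<open>c\<close> term becomes the form of
      \<open>S\<close> at \<open>u\<close>.\<close>
    have xM: "x \<bullet> (M *v v) = u \<bullet> (S *v v)" for v
      using hermitian_inner[OF hM, of x v] Mx S_sym by simp
    have "x \<bullet> (A *v u) + x \<bullet> (S *v u) + c * (x \<bullet> (M *v u)) = x \<bullet> (A *v ut) + x \<bullet> (M *v h)"
      using arg_cong[OF eq, of "(\<bullet>) x"] by (simp only: inner_add_right inner_scaleR_right)
    then have "x \<bullet> (M *v x) + c * (u \<bullet> (S *v u)) = 0"
      using xA xM[of u] xM[of h] Mx C0D(2)[OF \<open>h \<in> C0 A B U\<close>] by simp
    moreover have "0 \<le> c * (u \<bullet> (S *v u))"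
      using S0 assms(5) by simp
    ultimately have "c * (u \<bullet> (S *v u)) = 0"
      using M0'[of x] by linarith
    then have "u \<bullet> (S *v u) = 0" using assms(5) by simp
    then have "ctranspose B *v u = 0" by (rule S_zero)
    \<comment> \<open>Although \<open>S *v u\<close> vanishes, keeping it in the multiplier makes
      this equation a mere rearrangement of the second system.\<close>
    moreover have "(A + c *\<^sub>R M) *v u + B *v (U *v (ctranspose B *v (ut + u))) = F"
    proof -
      have "B *v (U *v (ctranspose B *v (ut + u))) = S *v ut + S *v u"
        by (simp add: S_def BUBs_mult_vec matrix_vector_right_distrib)
      then show ?thesis
        using u by (simp add: Q_vec matrix_vector_mult_add_rdistrib scaleR_matrix_vector_mult
            algebra_simps)
    qed
    ultimately show ?thesis by (simp add: constrained_solution_def)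
  qed

  \<comment> \<open>The multipliers \<open>p\<close> and \<open>q\<close> may differ: the difference
    \<open>d\<close> satisfies the constraint, so it is orthogonal to the range of \<open>B\<close>,
    and testing with \<open>d\<close> removes them.\<close>
  have unique: "u = v"
    if u: "constrained_solution A M B c F u p" and v: "constrained_solution A M B c F v q" for u v p q
  proof (rule ccontr)
    define d where "d = u - v"
    assume "u \<noteq> v"
    then have "d \<noteq> 0" by (simp add: d_def)
    have Bd: "ctranspose B *v d = 0"
      using u v by (simp add: constrained_solution_def d_def matrix_vector_mult_diff_distrib)
    have "(A + c *\<^sub>R M) *v d + B *v (p - q) = 0"
      using u v by (auto simp: constrained_solution_def d_def matrix_vector_mult_diff_distrib
          algebra_simps)
    then have "d \<bullet> (A *v d + c *\<^sub>R (M *v d) + B *v (p - q)) = 0"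
      by (simp add: matrix_vector_mult_add_rdistrib scaleR_matrix_vector_mult)
    moreover have "d \<bullet> (B *v (p - q)) = 0"
      using inner_ctranspose[of B d "p - q"] Bd by simp
    ultimately have "d \<bullet> (A *v d) + c * (d \<bullet> (M *v d)) = 0"
      by (simp add: inner_add_right)
    moreover have "0 < c * (d \<bullet> (M *v d))"
      using M0[OF \<open>d \<noteq> 0\<close>] assms(5) by simp
    ultimately show False using A0[of d] by linarith
  qed

  have ex: "\<exists>!u. \<exists>p. constrained_solution A M B c F u p"
    using exP exQ solves unique by metis
  \<comment> \<open>A solution of the second system is constrained by \<open>solves\<close>, hence
    equals \<open>u\<close> by \<open>unique\<close>. Conversely, \<open>exQ\<close> supplies such a
    solution, which must then be \<open>u\<close>.\<close>
  have "Q *v v = F - S *v ut \<longleftrightarrow> v = u"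
    if "constrained_solution A M B c F u p" "P *v ut = F" for u p ut v
    using that exQ solves unique by metis
  then show ?thesis
    using eig ex exP unfolding P_def Q_def S_def by blast
qed

end
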